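(* Let $\pi_1:(P_1,\Sigma_1)\to(Q,\Sigma)$ and $\pi_2:(P_2,\Sigma_2)\to(Q,\Sigma)$ be morphisms in the category $\mathcal{P}$, and suppose that $(Q,\Sigma)$ has unique standard monomials. Then the fiber product object $(P_1,\Sigma_1)\times_{(Q,\Sigma)}(P_2,\Sigma_2)$ exists in $\mathcal{P}$.
   Context: For a lattice polytope $P\subset\mathbb{R}^n$, $X_P$ is its set of lattice points, $\mathbb{C}[X_P]$ is the polynomial ring with one variable per lattice point, $mP$ is the $m$-fold Minkowski sum, and $\mathbb{C}[P]$ is the graded algebra whose $m$-th graded component has as basis the lattice points of $mP$, with product given by addition. $I_P$ is the kernel of $\mathbb{C}[X_P]\to\mathbb{C}[P]$. A term order on $P$ is a function $\Sigma:X_P\to\mathbb{R}$. For a monomial $x^{\mathbf m}=x_1^{m_1}\cdots x_k^{m_k}$ put $\Sigma(\mathbf m)=\sum_i m_i\Sigma(x_i)$; monomials are (partially) ordered first by degree and then by the value of $\Sigma$. The initial form of a polynomial is the sum of its terms that are largest in this order. A monomial is standard with respect to $\Sigma$ if it is not the initial form of any polynomial in $I_P$. Equivalently, for a lattice point $b\in mP$ let $\Delta_b$ be the set of degree $m$ monomials of $\mathbb{C}[X_P]$ mapping to $b$; the standard monomials in $\Delta_b$ are those with minimal $\Sigma$-value. $(P,\Sigma)$ has unique standard monomials if each non-empty $\Delta_b$ has a unique minimal element. The category $\mathcal{P}$ has as objects pairs $(P,\Sigma)$, with $P$ a lattice polytope in some $\mathbb{R}^n$ and $\Sigma$ a term order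 on $P$. A morphism $\pi:(P,\Sigma)\to(Q,\Gamma)$ is a linear map $\pi:P\to Q$, induced by a map on lattices, such that standard monomials of $\Sigma$ map to standard monomials of $\Gamma$. Fiber product object means fiber product (pullback) in the categorical sense. *)

theory Defs
  imports
    "HOL-Analysis.Analysis"
    "HOL-Analysis.Finite_Function_Topology"
    "HOL-Library.Poly_Mapping"
    "HOL-Library.Set_Algebras"
    "HOL-Library.FuncSet"
begin

text \<open>
  Objects of the category live in \<open>\<real>^n\<close> for varying \<open>n\<close>, and the universal property of a
  fiber product quantifies over all of them. We therefore realise every \<open>\<real>^n\<close> inside the real
  vector space \<open>nat \<Rightarrow>\<^sub>0 real\<close> of finitely supported sequences, as the sequences supported
  in \<open>{..<n}\<close>.
\<close>

type_synonym pt = "nat \<Rightarrow>\<^sub>0 real"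

definition integral_pt :: "pt \<Rightarrow> bool" where
  "integral_pt x \<longleftrightarrow> (\<forall>i. Poly_Mapping.lookup x i \<in> \<int>)"

definition int_lattice :: "nat \<Rightarrow> pt set" where
  "int_lattice n = {x. Poly_Mapping.keys x \<subseteq> {..<n} \<and> integral_pt x}"

text \<open>The empty polytope (the convex hull of no points) is included: a fiber product of nonempty
  polytopes can be empty.\<close>

definition lattice_polytope :: "nat \<Rightarrow> pt set \<Rightarrow> bool" where
  "lattice_polytope n P \<longleftrightarrow> (\<exists>S. finite S \<and> S \<subseteq> int_lattice n \<and> P = convex hull S)"

definition lattice_points :: "pt set \<Rightarrow> pt set" where
  "lattice_points P = {x \<in> P. integral_pt x}"

text \<open>The sum below is the Minkowski sum of sets; for \<open>m = 0\<close> it is \<open>{0}\<close>, also when \<open>P\<close> is empty.\<close>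

definition multiple :: "nat \<Rightarrow> pt set \<Rightarrow> pt set" where
  "multiple m P = (\<Sum>i<m. P)"


subsection \<open>The polynomial ring, the graded algebra of a polytope and the toric ideal\<close>

text \<open>A monomial is its exponent function; a polynomial is a finitely supported family of
  coefficients, multiplied by convolution.\<close>

type_synonym monom = "pt \<Rightarrow>\<^sub>0 nat"
type_synonym mpoly = "monom \<Rightarrow>\<^sub>0 complex"

definition monomials :: "pt set \<Rightarrow> monom set" where
  "monomials P = {u. Poly_Mapping.keys u \<subseteq> lattice_points P}"

definition poly_ring :: "pt set \<Rightarrow> mpoly set" where
  "poly_ring P = {f. Poly_Mapping.keys f \<subseteq> monomials P}"

text \<open>The basis element for the lattice point \<open>b\<close> of \<open>m P\<close> is \<open>Poly_Mapping.single (m, b) 1\<close>;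
  convolution makes the product of basis elements addition of lattice points and of degrees.\<close>

definition polytope_algebra :: "pt set \<Rightarrow> (nat \<times> pt \<Rightarrow>\<^sub>0 complex) set" where
  "polytope_algebra P =
     {g. Poly_Mapping.keys g \<subseteq> {(m, b). b \<in> lattice_points (multiple m P)}}"

text \<open>The algebra homomorphism which sends the variable of a lattice point \<open>x\<close> to \<open>x\<close> in degree 1.\<close>

definition toric_hom :: "mpoly \<Rightarrow> (nat \<times> pt \<Rightarrow>\<^sub>0 complex)" where
  "toric_hom f = (\<Sum>u\<in>Poly_Mapping.keys f. Poly_Mapping.single 0 (Poly_Mapping.lookup f u) *
     (\<Prod>x\<in>Poly_Mapping.keys u. Poly_Mapping.single (1, x) 1 ^ Poly_Mapping.lookup u x))"

definition toric_ideal :: "pt set \<Rightarrow> mpoly set" where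
  "toric_ideal P = {f \<in> poly_ring P. toric_hom f = 0}"


subsection \<open>Term orders and standard monomials\<close>

definition mdegree :: "monom \<Rightarrow> nat" where
  "mdegree u = (\<Sum>x\<in>Poly_Mapping.keys u. Poly_Mapping.lookup u x)"

definition mweight :: "(pt \<Rightarrow> real) \<Rightarrow> monom \<Rightarrow> real" where
  "mweight w u = (\<Sum>x\<in>Poly_Mapping.keys u. real (Poly_Mapping.lookup u x) * w x)"

definition mono_le :: "(pt \<Rightarrow> real) \<Rightarrow> monom \<Rightarrow> monom \<Rightarrow> bool" where
  "mono_le w u v \<longleftrightarrow>
     mdegree u < mdegree v \<or> mdegree u = mdegree v \<and> mweight w u \<le> mweight w v"

definition initial_form :: "(pt \<Rightarrow> real) \<Rightarrow> mpoly \<Rightarrow> mpoly" where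
  "initial_form w f =
     (\<Sum>u\<in>{u \<in> Poly_Mapping.keys f. \<forall>v\<in>Poly_Mapping.keys f. mono_le w v u}.
        Poly_Mapping.single u (Poly_Mapping.lookup f u))"

definition standard :: "pt set \<Rightarrow> (pt \<Rightarrow> real) \<Rightarrow> monom \<Rightarrow> bool" where
  "standard P w u \<longleftrightarrow> u \<in> monomials P \<and>
     \<not> (\<exists>f\<in>toric_ideal P. initial_form w f = Poly_Mapping.single u 1)"

text \<open>The set \<open>\<Delta>_b\<close> for a lattice point \<open>b\<close> of \<open>m P\<close>.\<close>

definition monomials_over :: "pt set \<Rightarrow> nat \<Rightarrow> pt \<Rightarrow> monom set" where
  "monomials_over P m b = {u \<in> monomials P. mdegree u = m \<and>
     toric_hom (Poly_Mapping.single u 1) = Poly_Mapping.single (m, b) 1}"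

definition unique_standard_monomials :: "pt set \<Rightarrow> (pt \<Rightarrow> real) \<Rightarrow> bool" where
  "unique_standard_monomials P w \<longleftrightarrow>
     (\<forall>m. \<forall>b\<in>lattice_points (multiple m P). monomials_over P m b \<noteq> {} \<longrightarrow>
        (\<exists>!u. u \<in> monomials_over P m b \<and>
           (\<forall>v\<in>monomials_over P m b. mweight w u \<le> mweight w v)))"


subsection \<open>The category\<close>

record ordered_polytope =
  ambient_dim :: nat
  body :: "pt set"
  term_order :: "pt \<Rightarrow> real"

text \<open>Term orders and morphisms are functions on \<open>X\<^sub>P\<close> and \<open>P\<close>; being extensional
  (\<open>undefined\<close> elsewhere) makes equality of such functions equality in HOL.\<close>

definition obj :: "ordered_polytope \<Rightarrow> bool" where
  "obj X \<longleftrightarrow> lattice_polytope (ambient_dim X) (body X) \<and>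
     term_order X \<in> extensional (lattice_points (body X))"

abbreviation std_monomial :: "ordered_polytope \<Rightarrow> monom \<Rightarrow> bool" where
  "std_monomial X \<equiv> standard (body X) (term_order X)"

definition map_monom :: "(pt \<Rightarrow> pt) \<Rightarrow> monom \<Rightarrow> monom" where
  "map_monom p u =
     (\<Sum>x\<in>Poly_Mapping.keys u. Poly_Mapping.single (p x) (Poly_Mapping.lookup u x))"

text \<open>Only the values of \<open>A\<close> on \<open>\<real>^n\<close>, \<open>n\<close> the ambient dimension of \<open>X\<close>, matter below.
  There \<open>A\<close> is an arbitrary linear map to the \<open>\<real>^k\<close> of \<open>Y\<close> which restricts to the lattices.\<close>

definition Hom :: "ordered_polytope \<Rightarrow> ordered_polytope \<Rightarrow> (pt \<Rightarrow> pt) set" where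
  "Hom X Y = {p \<in> body X \<rightarrow>\<^sub>E body Y.
     (\<exists>A. linear A \<and> A ` int_lattice (ambient_dim X) \<subseteq> int_lattice (ambient_dim Y) \<and>
          (\<forall>x\<in>body X. p x = A x)) \<and>
     (\<forall>u. std_monomial X u \<longrightarrow> std_monomial Y (map_monom p u))}"

definition comp_mor :: "ordered_polytope \<Rightarrow> (pt \<Rightarrow> pt) \<Rightarrow> (pt \<Rightarrow> pt) \<Rightarrow> (pt \<Rightarrow> pt)" where
  "comp_mor X q p = compose (body X) q p"

text \<open>\<open>Z\<close> with projections \<open>p1 : Z \<rightarrow> X1\<close>, \<open>p2 : Z \<rightarrow> X2\<close> is a pullback of \<open>f1 : X1 \<rightarrow> Y\<close> and
  \<open>f2 : X2 \<rightarrow> Y\<close>; the test objects \<open>R\<close> range over all ambient dimensions.\<close>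

definition is_fiber_product ::
  "ordered_polytope \<Rightarrow> ordered_polytope \<Rightarrow> (pt \<Rightarrow> pt) \<Rightarrow> (pt \<Rightarrow> pt) \<Rightarrow>
   ordered_polytope \<Rightarrow> (pt \<Rightarrow> pt) \<Rightarrow> (pt \<Rightarrow> pt) \<Rightarrow> bool" where
  "is_fiber_product X1 X2 f1 f2 Z p1 p2 \<longleftrightarrow>
     obj Z \<and> p1 \<in> Hom Z X1 \<and> p2 \<in> Hom Z X2 \<and> comp_mor Z f1 p1 = comp_mor Z f2 p2 \<and>
     (\<forall>R r1 r2. obj R \<and> r1 \<in> Hom R X1 \<and> r2 \<in> Hom R X2 \<and>
        comp_mor R f1 r1 = comp_mor R f2 r2 \<longrightarrow>
        (\<exists>!h. h \<in> Hom R Z \<and> comp_mor R p1 h = r1 \<and> comp_mor R p2 h = r2))"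


subsection \<open>Consistency of the definitions\<close>

lemma single_pow: "Poly_Mapping.single (m::nat,b::pt) (1::complex) ^ k = Poly_Mapping.single (k*m, of_nat k *\<^sub>R b) 1"
proof (induction k)
  case 0
  have "(0::nat, 0::pt) = 0" by (simp add: zero_prod_def)
  then show ?case by simp
next
  case (Suc k)
  then show ?case by (simp add: mult_single scaleR_left_distrib plus_prod_def)
qed

definition mpt :: "monom \<Rightarrow> pt" where
  "mpt u = (\<Sum>x\<in>Poly_Mapping.keys u. real (Poly_Mapping.lookup u x) *\<^sub>R x)"

lemma prod_single: "finite A \<Longrightarrow> (\<Prod>x\<in>A. Poly_Mapping.single (f x :: nat,g x::pt) (1::complex)) = Poly_Mapping.single (sum f A, sum g A) 1"
proof (induction A rule: finite_induct)
  case empty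
  have "(0::nat, 0::pt) = 0" by (simp add: zero_prod_def)
  then show ?case by simp
next
  case (insert x F)
  then show ?case by (simp add: mult_single plus_prod_def)
qed

lemma toric_hom_alt: "toric_hom f = (\<Sum>u\<in>Poly_Mapping.keys f. Poly_Mapping.single (mdegree u, mpt u) (Poly_Mapping.lookup f u))"
  unfolding toric_hom_def single_pow
  by (rule sum.cong) (auto simp: prod_single mult_single mdegree_def mpt_def)

lemma toric_hom_single: "toric_hom (Poly_Mapping.single u 1) = Poly_Mapping.single (mdegree u, mpt u) 1"
  by (simp add: toric_hom_alt)

lemma monomials_over_alt: "monomials_over P m b = {u\<in>monomials P. mdegree u = m \<and> mpt u = b}"
proof -
  have "Poly_Mapping.single x (1::complex) = Poly_Mapping.single y 1 \<longleftrightarrow> x = y" for x y :: "nat \<times> pt"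
    by (metis lookup_single_eq lookup_single_not_eq zero_neq_one)
  then show ?thesis unfolding monomials_over_def toric_hom_single by auto
qed

lemma integral_pt_sum: "finite A \<Longrightarrow> (\<And>x. x\<in>A \<Longrightarrow> integral_pt (f x)) \<Longrightarrow> integral_pt (sum f A)"
  unfolding integral_pt_def by (auto simp: Poly_Mapping.lookup_sum intro!: Ints_sum)

lemma lookup_scaleR: "Poly_Mapping.lookup (c *\<^sub>R (x::pt)) i = c * Poly_Mapping.lookup x i"
  by (simp add: scaleR_poly_mapping_def Abs_poly_mapping_inverse)

lemma multiple_add: "multiple (m+n) P = multiple m P + multiple n P"
  unfolding multiple_def by (induction n) (auto simp: add.assoc[symmetric])

lemma multiple_scale: "x \<in> P \<Longrightarrow> real k *\<^sub>R x \<in> multiple k P"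
proof (induction k)
  case 0 then show ?case by (simp add: multiple_def)
next
  case (Suc k)
  have "real (Suc k) *\<^sub>R x = real k *\<^sub>R x + x" by (simp add: scaleR_left_distrib add.commute)
  moreover have "multiple (Suc k) P = multiple k P + P" by (simp add: multiple_def)
  ultimately show ?case using Suc by (simp add: set_plus_intro)
qed

lemma mpt_in: assumes "u \<in> monomials P" shows "mpt u \<in> lattice_points (multiple (mdegree u) P)"
proof -
  have "(\<Sum>x\<in>A. real (Poly_Mapping.lookup u x) *\<^sub>R x) \<in> multiple (\<Sum>x\<in>A. Poly_Mapping.lookup u x) P"
    if "finite A" "A \<subseteq> P" for A using that
    by (induction A rule: finite_induct) (auto simp: multiple_add multiple_scale set_plus_intro, simp add: multiple_def)
  moreover have "integral_pt (mpt u)" unfolding mpt_def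
    using assms by (intro integral_pt_sum) (auto simp: integral_pt_def lookup_scaleR monomials_def lattice_points_def)
  ultimately show ?thesis using assms
    by (auto simp: lattice_points_def mpt_def mdegree_def monomials_def subset_iff)
qed

lemma toric_hom_in_polytope_algebra: "f \<in> poly_ring P \<Longrightarrow> toric_hom f \<in> polytope_algebra P"
proof -
  assume f: "f \<in> poly_ring P"
  have "Poly_Mapping.keys (toric_hom f) \<subseteq> (\<Union>u\<in>Poly_Mapping.keys f. {(mdegree u, mpt u)})"
    unfolding toric_hom_alt by (rule order_trans[OF keys_sum]) auto
  then show ?thesis using f mpt_in by (fastforce simp: poly_ring_def polytope_algebra_def)
qed

lemma lookup_sum_single:
  "finite A \<Longrightarrow> Poly_Mapping.lookup (\<Sum>u\<in>A. Poly_Mapping.single u (f u)) v = (if v \<in> A then f v else 0)"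
  by (induction A rule: finite_induct) (auto simp: lookup_add lookup_single when_def)

lemma initial_lookup: "Poly_Mapping.lookup (initial_form w f) v =
  (if v\<in>Poly_Mapping.keys f \<and> (\<forall>t\<in>Poly_Mapping.keys f. mono_le w t v) then Poly_Mapping.lookup f v else 0)"
  unfolding initial_form_def by (subst lookup_sum_single) auto

text \<open>The standard monomials over \<open>b\<close> are those of minimal weight.\<close>

lemma standard_iff: "standard P w u \<longleftrightarrow> u \<in> monomials P \<and> (\<forall>v\<in>monomials_over P (mdegree u) (mpt u). mweight w u \<le> mweight w v)"
proof (cases "u \<in> monomials P")
  case False then show ?thesis by (simp add: standard_def)
next
  case True
  have "(\<exists>f\<in>toric_ideal P. initial_form w f = Poly_Mapping.single u 1) \<longleftrightarrow>
    (\<exists>v\<in>monomials_over P (mdegree u) (mpt u). mweight w v < mweight w u)"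
  proof
    assume "\<exists>v\<in>monomials_over P (mdegree u) (mpt u). mweight w v < mweight w u"
    then obtain v where v: "v \<in> monomials P" "mdegree v = mdegree u" "mpt v = mpt u" "mweight w v < mweight w u"
      by (auto simp: monomials_over_alt)
    then have ne: "v \<noteq> u" by auto
    define f :: mpoly where "f = Poly_Mapping.single u 1 - Poly_Mapping.single v 1"
    have l: "Poly_Mapping.lookup f x = (if x = u then 1 else if x = v then -1 else 0)" for x
      using ne by (auto simp: f_def lookup_minus lookup_single when_def)
    have k: "Poly_Mapping.keys f = {u,v}" by (auto simp: in_keys_iff l split: if_splits)
    have "toric_hom f = 0" unfolding toric_hom_alt k using ne v by (simp add: l single_add[symmetric])
    then have "f \<in> toric_ideal P" using k v True by (auto simp: toric_ideal_def poly_ring_def)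
    moreover have "initial_form w f = Poly_Mapping.single u 1"
      by (rule poly_mapping_eqI) (use v ne in \<open>auto simp: initial_lookup k l lookup_single when_def mono_le_def\<close>)
    ultimately show "\<exists>f\<in>toric_ideal P. initial_form w f = Poly_Mapping.single u 1" by blast
  next
    assume "\<exists>f\<in>toric_ideal P. initial_form w f = Poly_Mapping.single u 1"
    then obtain f where f: "f \<in> toric_ideal P" "initial_form w f = Poly_Mapping.single u 1" by blast
    have i: "(if v\<in>Poly_Mapping.keys f \<and> (\<forall>t\<in>Poly_Mapping.keys f. mono_le w t v) then Poly_Mapping.lookup f v else 0)
      = (if v = u then 1 else 0)" for v
      unfolding initial_lookup[symmetric] f(2) by (simp add: lookup_single when_def)
    have u: "u \<in> Poly_Mapping.keys f" "\<forall>t\<in>Poly_Mapping.keys f. mono_le w t u"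
      using i[of u] zero_neq_one[where 'a=complex] by metis+
    have other: "v = u" if "v \<in> Poly_Mapping.keys f" "\<forall>t\<in>Poly_Mapping.keys f. mono_le w t v" for v
      using i[of v] that by (metis in_keys_iff)
    let ?B = "{v\<in>Poly_Mapping.keys f. mdegree v = mdegree u \<and> mpt v = mpt u}"
    have "0 = Poly_Mapping.lookup (toric_hom f) (mdegree u, mpt u)" using f by (simp add: toric_ideal_def)
    also have "\<dots> = (\<Sum>v\<in>?B. Poly_Mapping.lookup f v)"
      unfolding toric_hom_alt lookup_sum lookup_single
      by (subst sum.inter_filter) (auto simp: when_def intro: sum.cong)
    finally have s: "(\<Sum>v\<in>?B. Poly_Mapping.lookup f v) = 0" by simp
    have "?B \<noteq> {u}" using s u(1) by (auto simp: in_keys_iff)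
    then obtain v where v: "v\<in>?B" "v \<noteq> u" using u by auto
    have "mweight w v < mweight w u"
    proof (rule ccontr)
      assume "\<not> ?thesis"
      with v have "mono_le w u v" by (auto simp: mono_le_def)
      with u have "\<forall>t\<in>Poly_Mapping.keys f. mono_le w t v" by (auto simp: mono_le_def) 
      with other v show False by auto
    qed
    moreover have "v \<in> monomials P" using v f by (auto simp: toric_ideal_def poly_ring_def)
    ultimately show "\<exists>v\<in>monomials_over P (mdegree u) (mpt u). mweight w v < mweight w u"
      using v by (auto simp: monomials_over_alt)
  qed
  then show ?thesis using True by (simp add: standard_def not_less)
qed

lemma map_monom_super: "finite A \<Longrightarrow> Poly_Mapping.keys u \<subseteq> A \<Longrightarrow> map_monom p u = (\<Sum>x\<in>A. Poly_Mapping.single (p x) (Poly_Mapping.lookup u x))"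
  unfolding map_monom_def by (rule sum.mono_neutral_left) (auto simp: in_keys_iff)

lemma map_monom_id: "(\<And>x. x \<in> Poly_Mapping.keys u \<Longrightarrow> p x = x) \<Longrightarrow> map_monom p u = u"
proof -
  assume "\<And>x. x \<in> Poly_Mapping.keys u \<Longrightarrow> p x = x"
  then have "map_monom p u = (\<Sum>x\<in>Poly_Mapping.keys u. Poly_Mapping.single x (Poly_Mapping.lookup u x))"
    unfolding map_monom_def by (intro sum.cong) auto
  also have "\<dots> = u" by (rule poly_mapping_eqI) (simp add: lookup_sum_single in_keys_iff)
  finally show ?thesis .
qed

lemma map_monom_add: "map_monom p (u+v) = map_monom p u + map_monom p v"
proof -
  let ?A = "Poly_Mapping.keys u \<union> Poly_Mapping.keys v"
  show ?thesis
    using keys_add[of u v] by (simp add: map_monom_super[of ?A] lookup_add single_add sum.distrib)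
qed
lemma map_monom_single[simp]: "map_monom p (Poly_Mapping.single x k) = Poly_Mapping.single (p x) k"
  by (simp add: map_monom_def)
lemma map_monom_0[simp]: "map_monom p 0 = 0" by (simp add: map_monom_def)
lemma map_monom_sum: "finite A \<Longrightarrow> map_monom p (sum f A) = (\<Sum>x\<in>A. map_monom p (f x))"
  by (induction A rule: finite_induct) (auto simp: map_monom_add)
lemma map_monom_comp: "map_monom q (map_monom p u) = map_monom (q o p) u"
  by (simp add: map_monom_def[of p] map_monom_sum) (simp add: map_monom_def)

text \<open>Identities and composites of morphisms are morphisms.\<close>

lemma id_Hom: "obj X \<Longrightarrow> restrict id (body X) \<in> Hom X X"
  unfolding Hom_def
proof (intro CollectI conjI allI impI)
  show "\<exists>A. linear A \<and> A ` int_lattice (ambient_dim X) \<subseteq> int_lattice (ambient_dim X) \<and> (\<forall>x\<in>body X. restrict id (body X) x = A x)"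
    by (rule exI[of _ id]) (auto intro: linear_id)
next
  fix u assume u: "std_monomial X u"
  then have "map_monom (restrict id (body X)) u = u"
    by (intro map_monom_id) (auto simp: standard_def monomials_def lattice_points_def)
  then show "std_monomial X (map_monom (restrict id (body X)) u)" using u by simp
qed auto

lemma comp_Hom: assumes "p \<in> Hom X Y" "q \<in> Hom Y Z" shows "comp_mor X q p \<in> Hom X Z"
  unfolding Hom_def
proof (intro CollectI conjI allI impI)
  show "comp_mor X q p \<in> body X \<rightarrow>\<^sub>E body Z" using assms by (auto simp: Hom_def comp_mor_def compose_def)
  obtain A where A: "linear A" "A ` int_lattice (ambient_dim X) \<subseteq> int_lattice (ambient_dim Y)" "(\<forall>x\<in>body X. p x = A x)"
    using assms(1) unfolding Hom_def by auto
  obtain B where "linear B" "B ` int_lattice (ambient_dim Y) \<subseteq> int_lattice (ambient_dim Z)" "(\<forall>x\<in>body Y. q x = B x)"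
    using assms(2) unfolding Hom_def by auto
  with A show "\<exists>A. linear A \<and> A ` int_lattice (ambient_dim X) \<subseteq> int_lattice (ambient_dim Z) \<and> (\<forall>x\<in>body X. comp_mor X q p x = A x)"
    using assms[unfolded Hom_def, simplified, THEN conjunct1]
    by (intro exI[of _ "B o A"]) (fastforce simp: linear_compose comp_mor_def compose_def image_subset_iff dest: PiE_mem)
next
  fix u assume u: "std_monomial X u"
  have "map_monom (comp_mor X q p) u = map_monom (q o p) u"
    using u unfolding map_monom_def standard_def
    by (intro sum.cong) (auto simp: comp_mor_def compose_def monomials_def lattice_points_def)
  then show "std_monomial Z (map_monom (comp_mor X q p) u)" using u assms
    by (auto simp: map_monom_comp[symmetric] Hom_def)
qed

end

theory Submission
  imports Defs
begin

text \<open>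
  Let \<open>n\<^sub>i\<close> be the ambient dimension of \<open>P\<^sub>i\<close> and \<open>w\<^sub>i\<close> its term order. The real fiber product
  \<open>{(x, y). \<pi>1 x = \<pi>2 y}\<close> may fail to be a lattice polytope, so the fiber product object is the
  convex hull \<open>Z\<close> of its lattice points, inside \<open>\<real>^(n\<^sub>1 + n\<^sub>2)\<close>, with the term order which
  gives the lattice point \<open>(x, y)\<close> the weight \<open>w\<^sub>1 x + w\<^sub>2 y\<close>. A lattice polytope is the
  hull of its lattice points, so a pair of maps from a test object which agree over \<open>Q\<close> takes its lattice points, and therefore all of it, into \<open>Z\<close>.

  A monomial \<open>u\<close> over \<open>Z\<close> has two components \<open>u\<^sub>1\<close> and \<open>u\<^sub>2\<close>, its images over \<open>P1\<close> and \<open>P2\<close>.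
  The degree of \<open>u\<close> is that of either component, the point below \<open>u\<close> is the pair of the points
  below the components, and the weight of \<open>u\<close> is the sum of their weights. Hence \<open>u\<close> is standard
  if both components are (\<open>std_if_components_std\<close>), and this makes the map into \<open>Z\<close> induced by a
  cone a morphism.

  Conversely, let \<open>u\<close> be standard (\<open>components_std\<close>). Choose standard monomials \<open>v\<^sub>1\<close> and \<open>v\<^sub>2\<close> over
  the same points as \<open>u\<^sub>1\<close> and \<open>u\<^sub>2\<close>. Their images in \<open>Q\<close> are standard and lie over the same point,
  so they are equal because \<open>Q\<close> has unique standard monomials. Equality of the two images as
  monomials means that the factors of \<open>v\<^sub>1\<close> can be paired with those of \<open>v\<^sub>2\<close> so that paired factors
  agree over \<open>Q\<close> (\<open>map_monom_match\<close>), so \<open>v\<^sub>1\<close> and \<open>v\<^sub>2\<close> are the components of a monomial over \<open>Z\<close>.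
  Its weight is at least that of \<open>u\<close>; hence \<open>u\<^sub>1\<close> and \<open>u\<^sub>2\<close> have minimal weight as well. So the
  projections from \<open>Z\<close> are morphisms.
\<close>


section \<open>Lattice points of a lattice polytope\<close>

lemma finite_poly_mappings:
  assumes "finite A" and "finite B"
  shows "finite {x :: 'a \<Rightarrow>\<^sub>0 'b::zero. Poly_Mapping.keys x \<subseteq> A \<and> (\<forall>i\<in>A. Poly_Mapping.lookup x i \<in> B)}"
    (is "finite ?S")
proof (rule finite_imageD)
  show "inj_on (\<lambda>x. restrict (Poly_Mapping.lookup x) A) ?S"
  proof (rule inj_onI)
    fix x y assume x: "x \<in> ?S" and y: "y \<in> ?S"
      and eq: "restrict (Poly_Mapping.lookup x) A = restrict (Poly_Mapping.lookup y) A"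
    show "x = y"
    proof (rule poly_mapping_eqI)
      fix k show "Poly_Mapping.lookup x k = Poly_Mapping.lookup y k"
      proof (cases "k \<in> A")
        case True
        then show ?thesis using fun_cong[OF eq, of k] by simp
      next
        case False
        then have "k \<notin> Poly_Mapping.keys x" "k \<notin> Poly_Mapping.keys y" using x y by auto
        then show ?thesis by (simp add: in_keys_iff)
      qed
    qed
  qed
  show "finite ((\<lambda>x. restrict (Poly_Mapping.lookup x) A) ` ?S)"
    by (rule finite_subset[OF _ finite_PiE[OF assms(1), of "\<lambda>_. B"]]) (use assms in auto)
qed

lemma convex_box:
  "convex {x :: pt. Poly_Mapping.keys x \<subseteq> {..<n} \<and> (\<forall>i. \<bar>Poly_Mapping.lookup x i\<bar> \<le> M)}"
proof (rule convexI, clarify, intro conjI allI subsetI)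
  fix x y :: pt and a b :: real and i
  assume a: "0 \<le> a" "0 \<le> b" "a + b = 1"
    and x: "Poly_Mapping.keys x \<subseteq> {..<n}" and xM: "\<forall>i. \<bar>Poly_Mapping.lookup x i\<bar> \<le> M"
    and y: "Poly_Mapping.keys y \<subseteq> {..<n}" and yM: "\<forall>i. \<bar>Poly_Mapping.lookup y i\<bar> \<le> M"
  have l: "Poly_Mapping.lookup (a *\<^sub>R x + b *\<^sub>R y) i
      = a * Poly_Mapping.lookup x i + b * Poly_Mapping.lookup y i"
    by (simp add: lookup_add lookup_scaleR)
  have "\<bar>Poly_Mapping.lookup (a *\<^sub>R x + b *\<^sub>R y) i\<bar>
      \<le> a * \<bar>Poly_Mapping.lookup x i\<bar> + b * \<bar>Poly_Mapping.lookup y i\<bar>"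
    unfolding l using a(1,2) by (intro order_trans[OF abs_triangle_ineq]) (simp add: abs_mult)
  also have "\<dots> \<le> M"
    using a xM yM by (intro convex_bound_le) auto
  finally show "\<bar>Poly_Mapping.lookup (a *\<^sub>R x + b *\<^sub>R y) i\<bar> \<le> M" .
  show "i \<in> {..<n}" if "i \<in> Poly_Mapping.keys (a *\<^sub>R x + b *\<^sub>R y)"
  proof (rule ccontr)
    assume "i \<notin> {..<n}"
    then have "i \<notin> Poly_Mapping.keys x" "i \<notin> Poly_Mapping.keys y" using x y by auto
    then show False using that l by (simp add: in_keys_iff)
  qed
qed

lemma lattice_polytope_bounded:
  assumes "lattice_polytope n P"
  obtains M where
    "P \<subseteq> {x. Poly_Mapping.keys x \<subseteq> {..<n} \<and> (\<forall>i. \<bar>Poly_Mapping.lookup x i\<bar> \<le> M)}"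
proof -
  obtain S where S: "finite S" "S \<subseteq> int_lattice n" "P = convex hull S"
    using assms by (auto simp: lattice_polytope_def)
  define M where "M = (\<Sum>s\<in>S. \<Sum>i\<in>Poly_Mapping.keys s. \<bar>Poly_Mapping.lookup s i\<bar>)"
  have "\<bar>Poly_Mapping.lookup s i\<bar> \<le> M" if "s \<in> S" for s i
  proof -
    have "\<bar>Poly_Mapping.lookup s i\<bar> \<le> (\<Sum>i\<in>Poly_Mapping.keys s. \<bar>Poly_Mapping.lookup s i\<bar>)"
      by (cases "i \<in> Poly_Mapping.keys s")
        (auto intro: member_le_sum sum_nonneg simp: in_keys_iff)
    also have "\<dots> \<le> M"
      unfolding M_def using that S(1)
      by (intro member_le_sum[of s S "\<lambda>s. \<Sum>i\<in>Poly_Mapping.keys s. \<bar>Poly_Mapping.lookup s i\<bar>"])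
        (auto intro: sum_nonneg)
    finally show ?thesis .
  qed
  then have "P \<subseteq> {x. Poly_Mapping.keys x \<subseteq> {..<n} \<and> (\<forall>i. \<bar>Poly_Mapping.lookup x i\<bar> \<le> M)}"
    unfolding S(3) using S(2) by (intro hull_minimal convex_box) (auto simp: int_lattice_def)
  then show thesis by (rule that)
qed

lemma lattice_polytope_keys: "lattice_polytope n P \<Longrightarrow> x \<in> P \<Longrightarrow> Poly_Mapping.keys x \<subseteq> {..<n}"
  by (rule lattice_polytope_bounded[of n P]) auto

lemma lattice_polytope_convex: "lattice_polytope n P \<Longrightarrow> convex P"
  by (auto simp: lattice_polytope_def)

lemma lattice_points_int_lattice: "lattice_polytope n P \<Longrightarrow> lattice_points P \<subseteq> int_lattice n"
  using lattice_polytope_keys by (auto simp: lattice_points_def int_lattice_def)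

lemma finite_lattice_points:
  assumes "lattice_polytope n P"
  shows "finite (lattice_points P)"
proof -
  obtain M where M:
    "P \<subseteq> {x. Poly_Mapping.keys x \<subseteq> {..<n} \<and> (\<forall>i. \<bar>Poly_Mapping.lookup x i\<bar> \<le> M)}"
    using lattice_polytope_bounded[OF assms] by blast
  show ?thesis
    by (rule finite_subset[OF _ finite_poly_mappings[of "{..<n}" "{k\<in>\<int>. \<bar>k\<bar> \<le> M}"]])
      (use M in \<open>auto simp: lattice_points_def integral_pt_def finite_abs_int_segment\<close>)
qed

lemma lattice_polytope_eq_hull:
  assumes "lattice_polytope n P"
  shows "P = convex hull (lattice_points P)"
proof
  obtain S where S: "finite S" "S \<subseteq> int_lattice n" "P = convex hull S"
    using assms by (auto simp: lattice_polytope_def)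
  then have "S \<subseteq> lattice_points P"
    by (auto simp: lattice_points_def int_lattice_def intro: hull_inc)
  then show "P \<subseteq> convex hull (lattice_points P)" unfolding S(3) by (rule hull_mono)
  show "convex hull (lattice_points P) \<subseteq> P"
    using lattice_polytope_convex[OF assms] by (intro hull_minimal) (auto simp: lattice_points_def)
qed


section \<open>Direct images of monomials\<close>

text \<open>Degree, weight and the point below a monomial are all sums over the factors of the monomial,
  which is what the next two lemmas abstract: the factors of a product are those of the two monomials
  together, and a direct image has the same factors, only renamed.\<close>

lemma sum_keys_add:
  fixes F :: "'a \<Rightarrow> nat \<Rightarrow> 'b::comm_monoid_add"
  assumes F0: "\<And>x. F x 0 = 0" and Fadd: "\<And>x a b. F x (a + b) = F x a + F x b"
  shows "(\<Sum>x\<in>Poly_Mapping.keys (u + v). F x (Poly_Mapping.lookup (u + v) x))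
       = (\<Sum>x\<in>Poly_Mapping.keys u. F x (Poly_Mapping.lookup u x))
       + (\<Sum>x\<in>Poly_Mapping.keys v. F x (Poly_Mapping.lookup v x))"
proof -
  let ?A = "Poly_Mapping.keys u \<union> Poly_Mapping.keys v"
  have "(\<Sum>x\<in>Poly_Mapping.keys t. F x (Poly_Mapping.lookup t x)) = (\<Sum>x\<in>?A. F x (Poly_Mapping.lookup t x))"
    if "Poly_Mapping.keys t \<subseteq> ?A" for t
    using that by (intro sum.mono_neutral_left) (auto simp: in_keys_iff F0)
  from this[of "u + v"] this[of u] this[of v] show ?thesis
    using keys_add[of u v] by (simp add: lookup_add Fadd sum.distrib)
qed

lemma sum_keys_map_monom:
  fixes F :: "pt \<Rightarrow> nat \<Rightarrow> 'a::comm_monoid_add"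
  assumes F0: "\<And>x. F x 0 = 0" and Fadd: "\<And>x a b. F x (a + b) = F x a + F x b"
  shows "(\<Sum>y\<in>Poly_Mapping.keys (map_monom p u). F y (Poly_Mapping.lookup (map_monom p u) y))
       = (\<Sum>x\<in>Poly_Mapping.keys u. F (p x) (Poly_Mapping.lookup u x))"
proof -
  define \<Phi> where "\<Phi> v = (\<Sum>x\<in>Poly_Mapping.keys v. F x (Poly_Mapping.lookup v x))" for v
  have single: "\<Phi> (Poly_Mapping.single x k) = F x k" for x k
    by (simp add: \<Phi>_def F0)
  have sum: "\<Phi> (sum g A) = (\<Sum>x\<in>A. \<Phi> (g x))" if "finite A" for g :: "pt \<Rightarrow> monom" and A
    using that
    by (induction A rule: finite_induct) (simp_all add: \<Phi>_def sum_keys_add[of F, OF F0 Fadd])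
  have "\<Phi> (map_monom p u) = (\<Sum>x\<in>Poly_Mapping.keys u. F (p x) (Poly_Mapping.lookup u x))"
    by (simp add: map_monom_def sum single)
  then show ?thesis by (simp add: \<Phi>_def)
qed

lemma mdegree_add: "mdegree (u + v) = mdegree u + mdegree v"
  unfolding mdegree_def by (rule sum_keys_add) auto

lemma mdegree_single: "mdegree (Poly_Mapping.single x k) = k"
  by (simp add: mdegree_def)

lemma mdegree_map_monom [simp]: "mdegree (map_monom p u) = mdegree u"
  unfolding mdegree_def by (rule sum_keys_map_monom) auto

lemma mweight_map_monom: "mweight w (map_monom p u) = mweight (\<lambda>x. w (p x)) u"
  unfolding mweight_def by (rule sum_keys_map_monom) (auto simp: distrib_right)

lemma mpt_map_monom:
  assumes "linear A" and "\<And>x. x \<in> Poly_Mapping.keys u \<Longrightarrow> p x = A x"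
  shows "mpt (map_monom p u) = A (mpt u)"
proof -
  have "mpt (map_monom p u) = (\<Sum>x\<in>Poly_Mapping.keys u. real (Poly_Mapping.lookup u x) *\<^sub>R p x)"
    unfolding mpt_def by (rule sum_keys_map_monom) (auto simp: scaleR_left_distrib)
  also have "\<dots> = A (mpt u)"
    unfolding mpt_def linear_sum[OF assms(1)]
    by (rule sum.cong) (auto simp: assms linear_cmul[OF assms(1)])
  finally show ?thesis .
qed

lemma map_monom_cong:
  "(\<And>x. x \<in> Poly_Mapping.keys u \<Longrightarrow> p x = q x) \<Longrightarrow> map_monom p u = map_monom q u"
  by (simp add: map_monom_def)

text \<open>No cancellation can occur between exponents, which are natural numbers.\<close>

lemma keys_map_monom: "Poly_Mapping.keys (map_monom p u) = p ` Poly_Mapping.keys u"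
proof -
  have "Poly_Mapping.lookup (map_monom p u) y
      = (\<Sum>x\<in>Poly_Mapping.keys u. if p x = y then Poly_Mapping.lookup u x else 0)" for y
    by (simp add: map_monom_def lookup_sum lookup_single when_def)
  then have "y \<in> Poly_Mapping.keys (map_monom p u) \<longleftrightarrow> y \<in> p ` Poly_Mapping.keys u" for y
    by (force simp: in_keys_iff)
  then show ?thesis by blast
qed

lemma mdegree_eq_0_iff: "mdegree u = 0 \<longleftrightarrow> u = 0"
  by (auto simp: mdegree_def in_keys_iff intro: poly_mapping_eqI)

lemma remove_factor:
  assumes "x \<in> Poly_Mapping.keys (u :: monom)"
  obtains u' where "u = Poly_Mapping.single x 1 + u'"
proof
  show "u = Poly_Mapping.single x 1 + (u - Poly_Mapping.single x 1)"
    by (rule poly_mapping_eqI)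
      (use assms in \<open>auto simp: in_keys_iff lookup_add lookup_minus lookup_single when_def\<close>)
qed

text \<open>Two monomials with the same direct image, written as products of variables, can be matched
  factor by factor: a factor \<open>x\<close> of the first goes with a factor \<open>y\<close> of the second which has the
  same image, and removing both leaves monomials whose direct images still agree. The function \<open>j\<close>
  encodes the pairs and \<open>p\<close>, \<open>q\<close> decode them.\<close>

lemma map_monom_match:
  assumes "map_monom f u = map_monom g v"
    and "\<And>x y. x \<in> Poly_Mapping.keys u \<Longrightarrow> y \<in> Poly_Mapping.keys v \<Longrightarrow> p (j x y) = x \<and> q (j x y) = y"
  shows "\<exists>t. Poly_Mapping.keys t \<subseteq>
           {j x y |x y. x \<in> Poly_Mapping.keys u \<and> y \<in> Poly_Mapping.keys v \<and> f x = g y} \<and>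
           map_monom p t = u \<and> map_monom q t = v"
  using assms
proof (induction "mdegree u" arbitrary: u v)
  case 0
  then have u: "u = 0" by (simp add: mdegree_eq_0_iff)
  have "mdegree v = mdegree u" using 0 by (metis mdegree_map_monom)
  then have v: "v = 0" using 0 by (metis mdegree_eq_0_iff)
  show ?case by (rule exI[of _ 0]) (simp add: u v)
next
  case (Suc k)
  then have "Poly_Mapping.keys u \<noteq> {}" by (auto simp: mdegree_def)
  then obtain x where x: "x \<in> Poly_Mapping.keys u" by blast
  then have "f x \<in> Poly_Mapping.keys (map_monom g v)"
    unfolding Suc.prems(1)[symmetric] keys_map_monom by simp
  then obtain y where y: "y \<in> Poly_Mapping.keys v" "f x = g y"
    by (auto simp: keys_map_monom)
  obtain u' where u': "u = Poly_Mapping.single x 1 + u'" by (rule remove_factor[OF x])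
  obtain v' where v': "v = Poly_Mapping.single y 1 + v'" by (rule remove_factor[OF y(1)])
  have ku: "Poly_Mapping.keys u' \<subseteq> Poly_Mapping.keys u"
    by (auto simp: u' in_keys_iff lookup_add)
  have kv: "Poly_Mapping.keys v' \<subseteq> Poly_Mapping.keys v"
    by (auto simp: v' in_keys_iff lookup_add)
  have "k = mdegree u'" using Suc.hyps(2) by (simp add: u' mdegree_add mdegree_single)
  moreover have "map_monom f u' = map_monom g v'"
    using Suc.prems(1) y(2) by (simp add: u' v' map_monom_add)
  ultimately obtain t where t:
    "Poly_Mapping.keys t \<subseteq>
       {j x y |x y. x \<in> Poly_Mapping.keys u' \<and> y \<in> Poly_Mapping.keys v' \<and> f x = g y}"
    "map_monom p t = u'" "map_monom q t = v'"
    using Suc.hyps(1)[of u' v'] Suc.prems(2) ku kv by blast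
  show ?case
  proof (intro exI conjI)
    show "Poly_Mapping.keys (Poly_Mapping.single (j x y) 1 + t) \<subseteq>
       {j x y |x y. x \<in> Poly_Mapping.keys u \<and> y \<in> Poly_Mapping.keys v \<and> f x = g y}"
      using keys_add[of "Poly_Mapping.single (j x y) 1" t] t(1) ku kv x y by auto blast+
    show "map_monom p (Poly_Mapping.single (j x y) 1 + t) = u"
      using Suc.prems(2)[OF x y(1)] t by (simp add: map_monom_add u')
    show "map_monom q (Poly_Mapping.single (j x y) 1 + t) = v"
      using Suc.prems(2)[OF x y(1)] t by (simp add: map_monom_add v')
  qed
qed


section \<open>Standard monomials\<close>

lemma standard_alt:
  "standard P w u \<longleftrightarrow> u \<in> monomials P \<and>
     (\<forall>v\<in>monomials P. mdegree v = mdegree u \<longrightarrow> mpt v = mpt u \<longrightarrow> mweight w u \<le> mweight w v)"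
  by (auto simp: standard_iff monomials_over_alt)

lemma finite_monomials_over:
  assumes "finite (lattice_points P)"
  shows "finite (monomials_over P m b)"
proof (rule finite_subset[OF _ finite_poly_mappings[OF assms, of "{..m}"]])
  have "Poly_Mapping.lookup u x \<le> mdegree u" for u x
    unfolding mdegree_def
    by (cases "x \<in> Poly_Mapping.keys u") (auto intro: member_le_sum simp: in_keys_iff)
  then show "monomials_over P m b \<subseteq> {u. Poly_Mapping.keys u \<subseteq> lattice_points P \<and>
      (\<forall>x\<in>lattice_points P. Poly_Mapping.lookup u x \<in> {..m})}"
    by (auto simp: monomials_over_alt monomials_def)
qed simp

lemma ex_standard:
  assumes "finite (lattice_points P)" and "u \<in> monomials P"
  obtains v where "standard P w v" "mdegree v = mdegree u" "mpt v = mpt u"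
proof -
  let ?D = "monomials_over P (mdegree u) (mpt u)"
  have "finite ?D" "?D \<noteq> {}"
    using finite_monomials_over[OF assms(1)] assms(2) by (auto simp: monomials_over_alt)
  then obtain v where "is_arg_min (mweight w) (\<lambda>v. v \<in> ?D) v"
    using ex_is_arg_min_if_finite by blast
  then show thesis
    by (intro that[of v]) (auto simp: is_arg_min_linorder standard_alt monomials_over_alt)
qed

lemma unique_standard_monomialsD:
  assumes "unique_standard_monomials P w" and "standard P w u" and "standard P w v"
    and "mdegree u = mdegree v" and "mpt u = mpt v"
  shows "u = v"
proof -
  have u: "u \<in> monomials P" using assms(2) by (simp add: standard_def)
  have "\<exists>!t. t \<in> monomials_over P (mdegree u) (mpt u) \<and>
      (\<forall>s\<in>monomials_over P (mdegree u) (mpt u). mweight w t \<le> mweight w s)"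
    using assms(1) mpt_in[OF u] u unfolding unique_standard_monomials_def monomials_over_alt by blast
  then show ?thesis
    using assms(2-5) unfolding standard_iff monomials_over_alt by (metis (mono_tags, lifting) mem_Collect_eq)
qed


section \<open>Concatenation of coordinates\<close>

text \<open>These realise the product \<open>\<real>^n \<times> \<real>^m = \<real>^(n + m)\<close>, whose factors both sit inside the same space
  of sequences: the coordinates of the second factor are shifted by \<open>n\<close>.\<close>

definition join_pt :: "nat \<Rightarrow> pt \<Rightarrow> pt \<Rightarrow> pt" where
  "join_pt n x y = Abs_poly_mapping
     (\<lambda>i. if i < n then Poly_Mapping.lookup x i else Poly_Mapping.lookup y (i - n))"

definition fst_pt :: "nat \<Rightarrow> pt \<Rightarrow> pt" where
  "fst_pt n z = join_pt n z 0"

definition snd_pt :: "nat \<Rightarrow> pt \<Rightarrow> pt" where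
  "snd_pt n z = Poly_Mapping.map_key ((+) n) z"

lemma keys_below_iff:
  "Poly_Mapping.keys (x :: pt) \<subseteq> {..<n} \<longleftrightarrow> (\<forall>i\<ge>n. Poly_Mapping.lookup x i = 0)"
  by (auto simp: subset_iff in_keys_iff not_le[symmetric])

lemma lookup_join_pt: "Poly_Mapping.lookup (join_pt n x y) i =
    (if i < n then Poly_Mapping.lookup x i else Poly_Mapping.lookup y (i - n))"
proof -
  define g where "g i = (if i < n then Poly_Mapping.lookup x i else Poly_Mapping.lookup y (i - n))" for i
  have "{i. g i \<noteq> 0} \<subseteq> {..<n} \<union> (+) n ` Poly_Mapping.keys y"
  proof
    fix i assume i: "i \<in> {i. g i \<noteq> 0}"
    show "i \<in> {..<n} \<union> (+) n ` Poly_Mapping.keys y"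
    proof (cases "i < n")
      case False
      then have "i - n \<in> Poly_Mapping.keys y" "i = n + (i - n)"
        using i by (simp_all add: g_def in_keys_iff)
      then show ?thesis by (intro UnI2 image_eqI)
    qed simp
  qed
  then have "finite {i. g i \<noteq> 0}"
    by (rule finite_subset) simp
  then have "Poly_Mapping.lookup (Abs_poly_mapping g) = g" by (simp add: Abs_poly_mapping_inverse)
  moreover have "join_pt n x y = Abs_poly_mapping g" unfolding join_pt_def g_def ..
  ultimately show ?thesis by (simp add: g_def)
qed

lemma lookup_fst_pt: "Poly_Mapping.lookup (fst_pt n z) i = (if i < n then Poly_Mapping.lookup z i else 0)"
  by (simp add: fst_pt_def lookup_join_pt)

lemma lookup_snd_pt: "Poly_Mapping.lookup (snd_pt n z) i = Poly_Mapping.lookup z (n + i)"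
  by (simp add: snd_pt_def map_key.rep_eq)

lemma join_fst_snd: "join_pt n (fst_pt n z) (snd_pt n z) = z"
  by (rule poly_mapping_eqI) (simp add: lookup_join_pt lookup_fst_pt lookup_snd_pt)

lemma fst_join: "Poly_Mapping.keys x \<subseteq> {..<n} \<Longrightarrow> fst_pt n (join_pt n x y) = x"
  by (rule poly_mapping_eqI) (auto simp: lookup_join_pt lookup_fst_pt keys_below_iff)

lemma snd_join [simp]: "snd_pt n (join_pt n x y) = y"
  by (rule poly_mapping_eqI) (simp add: lookup_join_pt lookup_snd_pt)

lemma linear_fst_pt: "linear (fst_pt n)"
  by (rule linearI; rule poly_mapping_eqI) (auto simp: lookup_fst_pt lookup_add lookup_scaleR)

lemma linear_snd_pt: "linear (snd_pt n)"
  by (rule linearI; rule poly_mapping_eqI) (auto simp: lookup_snd_pt lookup_add lookup_scaleR)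

lemma linear_join_pt:
  assumes "linear A" and "linear B"
  shows "linear (\<lambda>x. join_pt n (A x) (B x))"
  by (rule linearI; rule poly_mapping_eqI)
    (auto simp: lookup_join_pt lookup_add lookup_scaleR
      linear_add[OF assms(1)] linear_add[OF assms(2)] linear_cmul[OF assms(1)] linear_cmul[OF assms(2)])

lemma int_lattice_join_pt:
  "x \<in> int_lattice n \<Longrightarrow> y \<in> int_lattice m \<Longrightarrow> join_pt n x y \<in> int_lattice (n + m)"
  by (auto simp: int_lattice_def integral_pt_def lookup_join_pt keys_below_iff)

lemma int_lattice_fst_pt: "z \<in> int_lattice k \<Longrightarrow> fst_pt n z \<in> int_lattice n"
  by (auto simp: int_lattice_def integral_pt_def lookup_fst_pt keys_below_iff)

lemma int_lattice_snd_pt: "z \<in> int_lattice (n + m) \<Longrightarrow> snd_pt n z \<in> int_lattice m"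
  by (auto simp: int_lattice_def integral_pt_def lookup_snd_pt keys_below_iff)


section \<open>Morphisms\<close>

lemma Hom_linear:
  assumes "p \<in> Hom X Y"
  obtains A where "linear A"
    "A ` int_lattice (ambient_dim X) \<subseteq> int_lattice (ambient_dim Y)" "\<And>x. x \<in> body X \<Longrightarrow> p x = A x"
  using assms by (auto simp: Hom_def)

lemma Hom_body: "p \<in> Hom X Y \<Longrightarrow> x \<in> body X \<Longrightarrow> p x \<in> body Y"
  by (auto simp: Hom_def)

lemma Hom_std: "p \<in> Hom X Y \<Longrightarrow> std_monomial X u \<Longrightarrow> std_monomial Y (map_monom p u)"
  by (auto simp: Hom_def)

lemma Hom_lattice_points:
  assumes "obj X" and "p \<in> Hom X Y" and "x \<in> lattice_points (body X)"
  shows "p x \<in> lattice_points (body Y)"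
proof -
  obtain A where A: "A ` int_lattice (ambient_dim X) \<subseteq> int_lattice (ambient_dim Y)"
    "\<And>x. x \<in> body X \<Longrightarrow> p x = A x"
    using Hom_linear[OF assms(2)] by metis
  have x: "x \<in> body X" "x \<in> int_lattice (ambient_dim X)"
    using assms lattice_points_int_lattice by (auto simp: obj_def lattice_points_def)
  then have "p x \<in> int_lattice (ambient_dim Y)" using A by auto
  with Hom_body[OF assms(2) x(1)] show ?thesis by (simp add: lattice_points_def int_lattice_def)
qed

lemma keys_monomials: "u \<in> monomials P \<Longrightarrow> x \<in> Poly_Mapping.keys u \<Longrightarrow> x \<in> lattice_points P"
  by (auto simp: monomials_def)

text \<open>A morphism extends to a linear map, which commutes with the sum that defines the point below a
  monomial. Hence the images of standard monomials over one point can be compared in the target.\<close>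

lemma Hom_mpt_cong:
  assumes "p \<in> Hom X Y" and "u \<in> monomials (body X)" and "v \<in> monomials (body X)"
    and "mpt u = mpt v"
  shows "mpt (map_monom p u) = mpt (map_monom p v)"
proof -
  obtain A where A: "linear A" "\<And>x. x \<in> body X \<Longrightarrow> p x = A x"
    using Hom_linear[OF assms(1)] by metis
  have "mpt (map_monom p t) = A (mpt t)" if "t \<in> monomials (body X)" for t
    using A keys_monomials[OF that] by (intro mpt_map_monom) (auto simp: lattice_points_def)
  then show ?thesis using assms by simp
qed


section \<open>The fiber product object\<close>

locale polytope_cospan =
  fixes X1 X2 Y :: ordered_polytope and f1 f2 :: "pt \<Rightarrow> pt"
  assumes obj1: "obj X1" and obj2: "obj X2"
    and f1: "f1 \<in> Hom X1 Y" and f2: "f2 \<in> Hom X2 Y"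
begin

abbreviation "n1 \<equiv> ambient_dim X1"

definition fiber_pairs :: "pt set" where
  "fiber_pairs = {join_pt n1 x y |x y.
     x \<in> lattice_points (body X1) \<and> y \<in> lattice_points (body X2) \<and> f1 x = f2 y}"

definition fiber :: ordered_polytope where
  "fiber = \<lparr>ambient_dim = n1 + ambient_dim X2, body = convex hull fiber_pairs,
     term_order = restrict (\<lambda>z. term_order X1 (fst_pt n1 z) + term_order X2 (snd_pt n1 z)) fiber_pairs\<rparr>"

definition proj1 :: "pt \<Rightarrow> pt" where "proj1 = restrict (fst_pt n1) (body fiber)"
definition proj2 :: "pt \<Rightarrow> pt" where "proj2 = restrict (snd_pt n1) (body fiber)"

lemma polytope1: "lattice_polytope n1 (body X1)"
  and polytope2: "lattice_polytope (ambient_dim X2) (body X2)"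
  using obj1 obj2 by (auto simp: obj_def)

lemma fst_join_body: "x \<in> body X1 \<Longrightarrow> fst_pt n1 (join_pt n1 x y) = x"
  using lattice_polytope_keys[OF polytope1] by (rule fst_join)

lemma fiber_pairs_int_lattice: "fiber_pairs \<subseteq> int_lattice (n1 + ambient_dim X2)"
  using lattice_points_int_lattice[OF polytope1] lattice_points_int_lattice[OF polytope2]
  by (auto simp: fiber_pairs_def intro!: int_lattice_join_pt)

lemma polytope_fiber: "lattice_polytope (ambient_dim fiber) (body fiber)"
proof -
  have "fiber_pairs \<subseteq> (\<lambda>(x, y). join_pt n1 x y) ` (lattice_points (body X1) \<times> lattice_points (body X2))"
    by (auto simp: fiber_pairs_def)
  then have "finite fiber_pairs"
    by (rule finite_subset)
      (simp add: finite_lattice_points[OF polytope1] finite_lattice_points[OF polytope2])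
  then show ?thesis
    using fiber_pairs_int_lattice by (auto simp: lattice_polytope_def fiber_def)
qed

text \<open>The three conditions are convex in \<open>z\<close>, the last one because \<open>f1\<close> and \<open>f2\<close> extend to linear
  maps, and they hold for the generating pairs.\<close>

lemma fiber_bodyD:
  assumes "z \<in> body fiber"
  shows "fst_pt n1 z \<in> body X1" and "snd_pt n1 z \<in> body X2" and "f1 (fst_pt n1 z) = f2 (snd_pt n1 z)"
proof -
  obtain A where A: "linear A" "\<And>x. x \<in> body X1 \<Longrightarrow> f1 x = A x" using Hom_linear[OF f1] by metis
  obtain B where B: "linear B" "\<And>x. x \<in> body X2 \<Longrightarrow> f2 x = B x" using Hom_linear[OF f2] by metis
  define C where "C = {z. fst_pt n1 z \<in> body X1} \<inter> {z. snd_pt n1 z \<in> body X2}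
    \<inter> {z. A (fst_pt n1 z) = B (snd_pt n1 z)}"
  have "convex {z. fst_pt n1 z \<in> body X1}" "convex {z. snd_pt n1 z \<in> body X2}"
    using convex_linear_vimage[OF linear_fst_pt lattice_polytope_convex[OF polytope1], of n1]
      convex_linear_vimage[OF linear_snd_pt lattice_polytope_convex[OF polytope2], of n1]
    by (simp_all add: vimage_def)
  moreover have "convex {z. A (fst_pt n1 z) = B (snd_pt n1 z)}"
    by (rule convexI)
      (simp add: linear_add[OF A(1)] linear_add[OF B(1)] linear_cmul[OF A(1)] linear_cmul[OF B(1)]
        linear_add[OF linear_fst_pt] linear_add[OF linear_snd_pt]
        linear_cmul[OF linear_fst_pt] linear_cmul[OF linear_snd_pt])
  ultimately have "convex C" unfolding C_def by (intro convex_Int)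
  moreover have "fiber_pairs \<subseteq> C"
    using A(2) B(2) by (auto simp: fiber_pairs_def C_def lattice_points_def fst_join_body)
  ultimately have "body fiber \<subseteq> C" by (simp add: fiber_def hull_minimal)
  then have "z \<in> C" using assms by blast
  then show "fst_pt n1 z \<in> body X1" and "snd_pt n1 z \<in> body X2"
    and "f1 (fst_pt n1 z) = f2 (snd_pt n1 z)"
    using A(2) B(2) by (auto simp: C_def)
qed

text \<open>Both components of a lattice point of the hull are integral, and by the previous lemma they lie in
  the polytopes and agree over \<open>Y\<close>. So the hull of the pairs contains no further lattice points, and
  the variables of the fiber product are exactly the pairs.\<close>

lemma lattice_points_fiber: "lattice_points (body fiber) = fiber_pairs"
proof
  show "fiber_pairs \<subseteq> lattice_points (body fiber)"
    using fiber_pairs_int_lattice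
    by (auto simp: lattice_points_def fiber_def int_lattice_def intro: hull_inc)
  show "lattice_points (body fiber) \<subseteq> fiber_pairs"
  proof
    fix z assume "z \<in> lattice_points (body fiber)"
    then have z: "z \<in> body fiber" "integral_pt z" by (auto simp: lattice_points_def)
    have "integral_pt (fst_pt n1 z)" "integral_pt (snd_pt n1 z)"
      using z(2) by (auto simp: integral_pt_def lookup_fst_pt lookup_snd_pt)
    then have "join_pt n1 (fst_pt n1 z) (snd_pt n1 z) \<in> fiber_pairs"
      unfolding fiber_pairs_def using fiber_bodyD[OF z(1)] by (auto simp: lattice_points_def)
    then show "z \<in> fiber_pairs" by (simp add: join_fst_snd)
  qed
qed

lemma obj_fiber: "obj fiber"
  unfolding obj_def using polytope_fiber by (simp add: lattice_points_fiber) (simp add: fiber_def)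


section \<open>Components of a monomial over the fiber product\<close>

context
  fixes u assumes u: "u \<in> monomials (body fiber)"
begin

lemma component1: "map_monom (fst_pt n1) u \<in> monomials (body X1)"
  and component2: "map_monom (snd_pt n1) u \<in> monomials (body X2)"
  and components_agree: "map_monom f1 (map_monom (fst_pt n1) u) = map_monom f2 (map_monom (snd_pt n1) u)"
proof -
  have k: "Poly_Mapping.keys u \<subseteq> fiber_pairs"
    using u by (simp add: monomials_def lattice_points_fiber)
  then show "map_monom (fst_pt n1) u \<in> monomials (body X1)" "map_monom (snd_pt n1) u \<in> monomials (body X2)"
    by (auto simp: monomials_def keys_map_monom fiber_pairs_def lattice_points_def fst_join_body
        dest!: subsetD)
  show "map_monom f1 (map_monom (fst_pt n1) u) = map_monom f2 (map_monom (snd_pt n1) u)"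
    unfolding map_monom_comp
  proof (rule map_monom_cong)
    fix z assume "z \<in> Poly_Mapping.keys u"
    then have "z \<in> body fiber" using keys_monomials[OF u] by (simp add: lattice_points_def)
    then show "(f1 \<circ> fst_pt n1) z = (f2 \<circ> snd_pt n1) z" by (simp add: fiber_bodyD)
  qed
qed

lemma mweight_components:
  "mweight (term_order fiber) u
     = mweight (term_order X1) (map_monom (fst_pt n1) u) + mweight (term_order X2) (map_monom (snd_pt n1) u)"
  unfolding mweight_map_monom unfolding mweight_def sum.distrib[symmetric]
proof (rule sum.cong)
  fix z assume "z \<in> Poly_Mapping.keys u"
  then have "z \<in> fiber_pairs" using keys_monomials[OF u] by (simp add: lattice_points_fiber)
  then show "real (Poly_Mapping.lookup u z) * term_order fiber z =
      real (Poly_Mapping.lookup u z) * term_order X1 (fst_pt n1 z) +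
      real (Poly_Mapping.lookup u z) * term_order X2 (snd_pt n1 z)"
    by (simp add: fiber_def distrib_left)
qed simp

end

lemma mpt_fst: "mpt (map_monom (fst_pt n1) u) = fst_pt n1 (mpt u)"
  and mpt_snd: "mpt (map_monom (snd_pt n1) u) = snd_pt n1 (mpt u)"
  by (rule mpt_map_monom; simp add: linear_fst_pt linear_snd_pt)+

text \<open>A monomial with the degree of \<open>u\<close> over the same point has components with the degree of those of
  \<open>u\<close> over the same points, so neither is lighter than the component of \<open>u\<close>; and weights add up.\<close>

lemma std_if_components_std:
  assumes u: "u \<in> monomials (body fiber)"
    and "std_monomial X1 (map_monom (fst_pt n1) u)" and "std_monomial X2 (map_monom (snd_pt n1) u)"
  shows "std_monomial fiber u"
  unfolding standard_alt
proof (intro conjI ballI impI)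
  fix v assume v: "v \<in> monomials (body fiber)" "mdegree v = mdegree u" "mpt v = mpt u"
  have "mweight (term_order X1) (map_monom (fst_pt n1) u) \<le> mweight (term_order X1) (map_monom (fst_pt n1) v)"
    using assms(2) component1[OF v(1)] v(2,3) by (simp add: standard_alt mpt_fst)
  moreover have "mweight (term_order X2) (map_monom (snd_pt n1) u) \<le> mweight (term_order X2) (map_monom (snd_pt n1) v)"
    using assms(3) component2[OF v(1)] v(2,3) by (simp add: standard_alt mpt_snd)
  ultimately show "mweight (term_order fiber) u \<le> mweight (term_order fiber) v"
    by (simp add: mweight_components u v(1))
qed (rule u)

text \<open>Unique standard monomials in the base make any two standard monomials over compatible points
  the components of a single monomial, so each component can be improved separately.\<close>

lemma components_std:
  assumes uniq: "unique_standard_monomials (body Y) (term_order Y)"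
    and std: "std_monomial fiber u"
  shows "std_monomial X1 (map_monom (fst_pt n1) u)" and "std_monomial X2 (map_monom (snd_pt n1) u)"
proof -
  let ?u1 = "map_monom (fst_pt n1) u" and ?u2 = "map_monom (snd_pt n1) u"
  have u: "u \<in> monomials (body fiber)" using std by (simp add: standard_def)
  obtain v1 where v1: "std_monomial X1 v1" "mdegree v1 = mdegree ?u1" "mpt v1 = mpt ?u1"
    using ex_standard[OF finite_lattice_points[OF polytope1] component1[OF u]] by blast
  obtain v2 where v2: "std_monomial X2 v2" "mdegree v2 = mdegree ?u2" "mpt v2 = mpt ?u2"
    using ex_standard[OF finite_lattice_points[OF polytope2] component2[OF u]] by blast
  have m1: "v1 \<in> monomials (body X1)" and m2: "v2 \<in> monomials (body X2)"
    using v1 v2 by (auto simp: standard_def)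
  have "map_monom f1 v1 = map_monom f2 v2"
  proof (rule unique_standard_monomialsD[OF uniq Hom_std[OF f1 v1(1)] Hom_std[OF f2 v2(1)]])
    show "mdegree (map_monom f1 v1) = mdegree (map_monom f2 v2)" using v1 v2 by simp
    show "mpt (map_monom f1 v1) = mpt (map_monom f2 v2)"
      using Hom_mpt_cong[OF f1 m1 component1[OF u] v1(3)] Hom_mpt_cong[OF f2 m2 component2[OF u] v2(3)]
      by (simp add: components_agree[OF u])
  qed
  moreover have "fst_pt n1 (join_pt n1 x y) = x \<and> snd_pt n1 (join_pt n1 x y) = y"
    if "x \<in> Poly_Mapping.keys v1" for x y
    using keys_monomials[OF m1 that] by (simp add: lattice_points_def fst_join_body)
  ultimately obtain v where v:
    "Poly_Mapping.keys v \<subseteq> {join_pt n1 x y |x y.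
        x \<in> Poly_Mapping.keys v1 \<and> y \<in> Poly_Mapping.keys v2 \<and> f1 x = f2 y}"
    "map_monom (fst_pt n1) v = v1" "map_monom (snd_pt n1) v = v2"
    using map_monom_match[of f1 v1 f2 v2 "fst_pt n1" "join_pt n1" "snd_pt n1"] by blast
  have vm: "v \<in> monomials (body fiber)"
    unfolding monomials_def lattice_points_fiber fiber_pairs_def
    using v(1) keys_monomials[OF m1] keys_monomials[OF m2] by blast
  have "fst_pt n1 (mpt v) = fst_pt n1 (mpt u)" "snd_pt n1 (mpt v) = snd_pt n1 (mpt u)"
    using v v1 v2 by (simp_all flip: mpt_fst mpt_snd)
  then have "mpt v = mpt u" by (metis join_fst_snd)
  moreover have "mdegree v = mdegree u" using v1(2) unfolding v(2)[symmetric] by simp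
  ultimately have "mweight (term_order fiber) u \<le> mweight (term_order fiber) v"
    using std vm by (simp add: standard_alt)
  then have "mweight (term_order X1) ?u1 + mweight (term_order X2) ?u2
      \<le> mweight (term_order X1) v1 + mweight (term_order X2) v2"
    by (simp add: mweight_components u vm v)
  moreover have "mweight (term_order X1) v1 \<le> mweight (term_order X1) ?u1"
    using v1 component1[OF u] by (simp add: standard_alt)
  moreover have "mweight (term_order X2) v2 \<le> mweight (term_order X2) ?u2"
    using v2 component2[OF u] by (simp add: standard_alt)
  ultimately have "mweight (term_order X1) ?u1 = mweight (term_order X1) v1"
    "mweight (term_order X2) ?u2 = mweight (term_order X2) v2" by linarith+
  then show "std_monomial X1 ?u1" "std_monomial X2 ?u2"
    using v1 v2 component1[OF u] component2[OF u] by (simp_all add: standard_alt)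
qed


section \<open>The universal property\<close>

lemma map_monom_proj:
  assumes "u \<in> monomials (body fiber)"
  shows "map_monom proj1 u = map_monom (fst_pt n1) u" and "map_monom proj2 u = map_monom (snd_pt n1) u"
  using keys_monomials[OF assms]
  by (auto intro!: map_monom_cong simp: proj1_def proj2_def lattice_points_def)

lemma proj_Hom:
  assumes "unique_standard_monomials (body Y) (term_order Y)"
  shows "proj1 \<in> Hom fiber X1" and "proj2 \<in> Hom fiber X2"
proof -
  have m: "u \<in> monomials (body fiber)" if "std_monomial fiber u" for u
    using that by (simp add: standard_def)
  have "fst_pt n1 ` int_lattice (ambient_dim fiber) \<subseteq> int_lattice n1"
    "snd_pt n1 ` int_lattice (ambient_dim fiber) \<subseteq> int_lattice (ambient_dim X2)"
    by (auto simp: fiber_def intro: int_lattice_fst_pt int_lattice_snd_pt)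
  then show "proj1 \<in> Hom fiber X1" and "proj2 \<in> Hom fiber X2"
    using linear_fst_pt[of n1] linear_snd_pt[of n1] components_std[OF assms] map_monom_proj[OF m] fiber_bodyD
    unfolding Hom_def by (auto simp: proj1_def proj2_def)
qed

definition induced :: "ordered_polytope \<Rightarrow> (pt \<Rightarrow> pt) \<Rightarrow> (pt \<Rightarrow> pt) \<Rightarrow> pt \<Rightarrow> pt" where
  "induced R r1 r2 = restrict (\<lambda>x. join_pt n1 (r1 x) (r2 x)) (body R)"

context
  fixes R r1 r2
  assumes R: "obj R" and r1: "r1 \<in> Hom R X1" and r2: "r2 \<in> Hom R X2"
    and commute: "comp_mor R f1 r1 = comp_mor R f2 r2"
begin

lemma induced_simps:
  assumes "x \<in> body R"
  shows "fst_pt n1 (induced R r1 r2 x) = r1 x" and "snd_pt n1 (induced R r1 r2 x) = r2 x"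
  using assms Hom_body[OF r1 assms] by (simp_all add: induced_def fst_join_body)

lemma induced_lattice_points:
  assumes "x \<in> lattice_points (body R)"
  shows "induced R r1 r2 x \<in> fiber_pairs"
proof -
  have x: "x \<in> body R" using assms by (simp add: lattice_points_def)
  have "f1 (r1 x) = f2 (r2 x)"
    using fun_cong[OF commute, of x] x by (simp add: comp_mor_def compose_def)
  then show ?thesis
    using Hom_lattice_points[OF R r1 assms] Hom_lattice_points[OF R r2 assms] x
    by (auto simp: induced_def fiber_pairs_def)
qed

lemma induced_Hom: "induced R r1 r2 \<in> Hom R fiber"
proof -
  let ?h = "induced R r1 r2"
  obtain A1 where A1: "linear A1" "A1 ` int_lattice (ambient_dim R) \<subseteq> int_lattice n1"
    "\<And>x. x \<in> body R \<Longrightarrow> r1 x = A1 x" using Hom_linear[OF r1] by metis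
  obtain A2 where A2: "linear A2" "A2 ` int_lattice (ambient_dim R) \<subseteq> int_lattice (ambient_dim X2)"
    "\<And>x. x \<in> body R \<Longrightarrow> r2 x = A2 x" using Hom_linear[OF r2] by metis
  define A where "A x = join_pt n1 (A1 x) (A2 x)" for x
  have A: "linear A" unfolding A_def using A1(1) A2(1) by (rule linear_join_pt)
  have hA: "?h x = A x" if "x \<in> body R" for x
    using that A1(3) A2(3) by (simp add: induced_def A_def)
  have lat: "A ` int_lattice (ambient_dim R) \<subseteq> int_lattice (ambient_dim fiber)"
    using A1(2) A2(2) by (auto simp: A_def fiber_def intro!: int_lattice_join_pt)
  have hull: "body R = convex hull (lattice_points (body R))"
    using R lattice_polytope_eq_hull by (auto simp: obj_def)
  have "A ` body R = convex hull (A ` lattice_points (body R))"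
    by (subst hull) (rule convex_hull_linear_image[OF A])
  also have "A ` lattice_points (body R) = ?h ` lattice_points (body R)"
    using hA by (auto simp: lattice_points_def)
  also have "convex hull \<dots> \<subseteq> body fiber"
    unfolding fiber_def using induced_lattice_points by (auto intro!: hull_mono)
  \<comment> \<open>The image is the hull of images of lattice points, which are pairs.\<close>
  finally have body: "?h ` body R \<subseteq> body fiber" using hA by auto
  have "std_monomial fiber (map_monom ?h u)" if u: "std_monomial R u" for u
  proof -
    have k: "x \<in> lattice_points (body R)" if "x \<in> Poly_Mapping.keys u" for x
      using u that keys_monomials by (auto simp: standard_def)
    have "map_monom (fst_pt n1) (map_monom ?h u) = map_monom r1 u"
      "map_monom (snd_pt n1) (map_monom ?h u) = map_monom r2 u"
      unfolding map_monom_comp using k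
      by (auto intro!: map_monom_cong simp: induced_simps lattice_points_def)
    moreover have "map_monom ?h u \<in> monomials (body fiber)"
      using k induced_lattice_points by (auto simp: monomials_def keys_map_monom lattice_points_fiber)
    ultimately show ?thesis
      using std_if_components_std[of "map_monom ?h u"] Hom_std[OF r1 u] Hom_std[OF r2 u] by simp
  qed
  moreover have "?h \<in> body R \<rightarrow>\<^sub>E body fiber" using body by (auto simp: induced_def)
  ultimately show ?thesis unfolding Hom_def using A lat hA by blast
qed

lemma comp_proj_iff:
  assumes "h \<in> Hom R fiber"
  shows "comp_mor R proj1 h = r1 \<and> comp_mor R proj2 h = r2 \<longleftrightarrow> h = induced R r1 r2"
proof
  have ext: "h \<in> extensional (body R)" "r1 \<in> extensional (body R)" "r2 \<in> extensional (body R)"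
    using assms r1 r2 by (auto simp: Hom_def PiE_def)
  have val: "proj1 (h x) = fst_pt n1 (h x)" "proj2 (h x) = snd_pt n1 (h x)" if "x \<in> body R" for x
    using Hom_body[OF assms that] by (auto simp: proj1_def proj2_def)
  show "comp_mor R proj1 h = r1 \<and> comp_mor R proj2 h = r2" if "h = induced R r1 r2"
    using that ext val by (auto simp: comp_mor_def compose_def induced_simps extensional_def fun_eq_iff)
  assume *: "comp_mor R proj1 h = r1 \<and> comp_mor R proj2 h = r2"
  show "h = induced R r1 r2"
  proof (rule extensionalityI[OF ext(1)])
    fix x assume x: "x \<in> body R"
    then have "fst_pt n1 (h x) = r1 x" "snd_pt n1 (h x) = r2 x"
      using * val[OF x] by (auto simp: comp_mor_def compose_def)
    then have "h x = join_pt n1 (r1 x) (r2 x)" by (metis join_fst_snd)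
    then show "h x = induced R r1 r2 x" using x by (simp add: induced_def)
  qed (simp add: induced_def)
qed

end

theorem fiber_is_fiber_product:
  assumes "unique_standard_monomials (body Y) (term_order Y)"
  shows "is_fiber_product X1 X2 f1 f2 fiber proj1 proj2"
  unfolding is_fiber_product_def
proof (intro conjI allI impI)
  show "obj fiber" by (rule obj_fiber)
  show "proj1 \<in> Hom fiber X1" "proj2 \<in> Hom fiber X2" by (rule proj_Hom[OF assms])+
  show "comp_mor fiber f1 proj1 = comp_mor fiber f2 proj2"
    by (auto simp: comp_mor_def compose_def proj1_def proj2_def fiber_bodyD)
next
  fix R r1 r2
  assume "obj R \<and> r1 \<in> Hom R X1 \<and> r2 \<in> Hom R X2 \<and> comp_mor R f1 r1 = comp_mor R f2 r2"
  then show "\<exists>!h. h \<in> Hom R fiber \<and> comp_mor R proj1 h = r1 \<and> comp_mor R proj2 h = r2"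
    using induced_Hom comp_proj_iff by metis
qed

end

theorem proposition1p17:
  fixes P1 P2 Q :: ordered_polytope and \<pi>1 \<pi>2 :: "pt \<Rightarrow> pt"
  assumes "obj P1" and "obj P2" and "obj Q"
    and "\<pi>1 \<in> Hom P1 Q" and "\<pi>2 \<in> Hom P2 Q"
    and "unique_standard_monomials (body Q) (term_order Q)"
  shows "\<exists>Z p1 p2. is_fiber_product P1 P2 \<pi>1 \<pi>2 Z p1 p2"
proof -
  interpret polytope_cospan P1 P2 Q \<pi>1 \<pi>2
    using assms by unfold_locales
  show ?thesis using fiber_is_fiber_product[OF assms(6)] by blast
qed

end
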